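(* Let $m$ and $r$ be nonnegative integers, and let $C$ and $D$ be sets of nonnegative integers such that $C \cup D = [0, m]$, $C \cap D = \{r\}$ and $0 \in C$. Then $R_{C}(n) = R_{D}(n)$ for every positive integer $n$ if and only if there exists a natural number $l$ such that $C = A_{2l} \cup (2^{2l} - 1 + B_{2l})$ and $D = B_{2l} \cup (2^{2l} - 1 + A_{2l})$.
   Context: Natural numbers are nonnegative integers, $\mathbb{N} = \{0,1,2,\dots\}$, and $[a,b]$ denotes the set of integers $x$ with $a \le x \le b$. For a set $S$ of nonnegative integers, $R_S(n)$ denotes the number of solutions of $s + s' = n$ with $s, s' \in S$ and $s < s'$. $A$ is the set of those nonnegative integers whose binary representation contains an even number of digits $1$ (so $0 \in A$), and $B = \mathbb{N} \setminus A$. For a natural number $l$, $A_l = A \cap [0, 2^l - 1]$ and $B_l = B \cap [0, 2^l - 1]$ (so $A_{2l} = A \cap [0, 2^{2l}-1]$ and $B_{2l} = B \cap [0, 2^{2l}-1]$). For a nonnegative integer $a$ and a set $S$ of nonnegative integers, $a + S = \{a + b : b \in S\}$. *)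

theory Defs
  imports Main
begin

definition rep_count :: "nat set \<Rightarrow> nat \<Rightarrow> nat" where
  "rep_count S n = card {(s, s'). s \<in> S \<and> s' \<in> S \<and> s < s' \<and> s + s' = n}"

text \<open>The index set below is finite for every natural number, so its cardinality
  is the number of digits 1 in the binary representation.\<close>

definition digit_ones :: "nat \<Rightarrow> nat" where
  "digit_ones n = card {i. bit n i}"

definition setA :: "nat set" where
  "setA = {n. even (digit_ones n)}"

definition setB :: "nat set" where
  "setB = UNIV - setA"

definition setA_upto :: "nat \<Rightarrow> nat set" where
  "setA_upto l = setA \<inter> {0..2 ^ l - 1}"

definition setB_upto :: "nat \<Rightarrow> nat set" where
  "setB_upto l = setB \<inter> {0..2 ^ l - 1}"

definition translate :: "nat \<Rightarrow> nat set \<Rightarrow> nat set" where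
  "translate a S = {a + b | b. b \<in> S}"

end

theory Submission
  imports Defs "HOL-Computational_Algebra.Polynomial"
begin

text \<open>
  Let F(z) be the difference of the generating polynomials of C and D. The two representation
  functions agree iff F(z) times the sum of the generating polynomials equals F(z^2), where the
  sum is 1 + z + ... + z^m + z^r. If C and D are the given Thue-Morse blocks with N = 2^(2l), then
  F(z) = T(z) (1 - z^(N-1)), where T(z) is the product of 1 - z^(2^i) over i < 2l, and the identity
  telescopes.

  Conversely, assume first that 2r \<le> m. Comparing coefficients gives a recurrence for the
  coefficients f of F. It makes f the Thue-Morse sign sequence t below r, forces t(r) = 1, and the
  requirement f(r + k) = 1 or -1 for 0 < k < r yields t(r + k) = t(k) for odd k. By the rigidity of
  Thue-Morse this is only possible if r = 2^(2l) - 1, and then f(r + k) = -t(k) for 0 < k \<le> r.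
  If the recurrence is continued past 2r, it yields f(2r + k) = -t(k - 1) for 0 < k \<le> r,
  f(3r + 1) = 1 and f(3r + 2) = -3, so m \<le> 3r + 1. The reflection x to m - x preserves the problem
  and replaces r by m - r; it shows t(m - r) = 1 and f(m) = -1, which leaves only m = 2r. It also
  reduces the case m < 2r to the case 2r \<le> m.
\<close>

subsection \<open>The Thue-Morse sign sequence\<close>

definition thue_morse :: "nat \<Rightarrow> int" where
  "thue_morse n = (if n \<in> setA then 1 else - 1)"

lemma finite_bits: "finite {i. bit (n :: nat) i}"
proof (rule finite_subset)
  show "{i. bit n i} \<subseteq> {..<n}"
  proof safe
    fix i assume "bit n i"
    then have "\<not> n < 2 ^ i" by (auto simp: bit_iff_odd)
    then show "i < n" using less_exp[of i] by linarith
  qed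
qed simp

lemma digit_ones_double: "digit_ones (2 * n) = digit_ones n"
proof -
  have "{i. bit (2 * n) i} = Suc ` {i. bit n i}"
  proof (rule set_eqI)
    fix i show "i \<in> {i. bit (2 * n) i} \<longleftrightarrow> i \<in> Suc ` {i. bit n i}"
      by (cases i) (auto simp: bit_Suc bit_0)
  qed
  then show ?thesis by (simp add: digit_ones_def card_image)
qed

lemma digit_ones_Suc_double: "digit_ones (Suc (2 * n)) = Suc (digit_ones n)"
proof -
  have "bit (Suc (2 * n)) i \<longleftrightarrow> i = 0 \<or> i \<in> Suc ` {i. bit n i}" for i
    by (cases i) (auto simp: bit_Suc bit_0)
  then have "{i. bit (Suc (2 * n)) i} = insert 0 (Suc ` {i. bit n i})" by auto
  then show ?thesis by (simp add: digit_ones_def card_image finite_bits)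
qed

lemma thue_morse_double [simp]: "thue_morse (2 * n) = thue_morse n"
  by (simp add: thue_morse_def setA_def digit_ones_double)

lemma thue_morse_Suc_double [simp]: "thue_morse (Suc (2 * n)) = - thue_morse n"
  by (simp add: thue_morse_def setA_def digit_ones_Suc_double)

lemma thue_morse_0 [simp]: "thue_morse 0 = 1"
proof -
  have "digit_ones 0 = 0" unfolding digit_ones_def by (subst card_eq_0_iff) simp
  then show ?thesis by (simp add: thue_morse_def setA_def)
qed

lemma thue_morse_1 [simp]: "thue_morse (Suc 0) = - 1"
  using thue_morse_Suc_double[of 0] by simp

lemma thue_morse_cases: "thue_morse n = 1 \<or> thue_morse n = - 1"
  by (simp add: thue_morse_def)

lemma thue_morse_Suc_even: "even n \<Longrightarrow> thue_morse (Suc n) = - thue_morse n"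
  by (auto elim!: evenE)

text \<open>Adding \<open>2 ^ k\<close> sets a digit above all those of \<open>n\<close>, so the
  parity flips. The induction strips the lowest digit, which leaves only the two doubling
  rules.\<close>

lemma thue_morse_add_power:
  "n < 2 ^ k \<Longrightarrow> thue_morse (2 ^ k + n) = - thue_morse n"
proof (induction k arbitrary: n)
  case 0
  then show ?case by simp
next
  case (Suc k)
  define j where "j = n div 2"
  have j: "j < 2 ^ k" using Suc.prems by (auto simp: j_def)
  have "n = 2 * j \<or> n = Suc (2 * j)" by (auto simp: j_def)
  then show ?case
  proof
    assume n: "n = 2 * j"
    then have "2 ^ Suc k + n = 2 * (2 ^ k + j)" by simp
    then show ?thesis using Suc.IH[OF j] n by (simp only: thue_morse_double)
  next
    assume n: "n = Suc (2 * j)"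
    then have "2 ^ Suc k + n = Suc (2 * (2 ^ k + j))" by simp
    then show ?thesis using Suc.IH[OF j] n by (simp only: thue_morse_Suc_double)
  qed
qed

lemma thue_morse_power_minus_1: "thue_morse (2 ^ k - 1) = (- 1) ^ k"
proof (induction k)
  case (Suc k)
  have "2 ^ Suc k - 1 = Suc (2 * (2 ^ k - 1 :: nat))"
    using one_le_power[of "2 :: nat" k] by (simp only: power_Suc) linarith
  then show ?case using Suc by (simp only: thue_morse_Suc_double) simp
qed simp

text \<open>Descent on \<open>s\<close>: even positions turn an even \<open>s\<close> into
  \<open>s div 2\<close>. For odd \<open>s\<close> at least 3, the values -1 at 1 and 2 are copied
  to \<open>s + 1\<close> and \<open>s + 2\<close>, but an even number and its successor have
  opposite signs.\<close>

lemma thue_morse_no_prefix_square: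
  assumes "s > 0" and "\<And>j. j < s \<Longrightarrow> thue_morse (s + j) = thue_morse j"
  shows False
  using assms
proof (induction s rule: less_induct)
  case (less s)
  have t2: "thue_morse 2 = - 1" using thue_morse_double[of 1] by simp
  show False
  proof (cases "even s")
    case True
    then obtain u where u: "s = 2 * u" by blast
    show False
    proof (rule less.IH[of u])
      show "u < s" "u > 0" using u less.prems by auto
      show "thue_morse (u + j) = thue_morse j" if "j < u" for j
        using less.prems(2)[of "2 * j"] that u
        by (metis distrib_left mult_less_mono2 thue_morse_double zero_less_numeral)
    qed
  next
    case False
    consider "s = 1" | "s \<ge> 3" using False by atomize_elim presburger
    then show False
    proof cases
      case 1
      then show False using less.prems(2)[of 0] by simp
    next
      case 2
      have "thue_morse (s + 1) = -1" "thue_morse (s + 2) = -1"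
        using less.prems(2)[of 1] less.prems(2)[of 2] 2 t2 by auto
      then show False using thue_morse_Suc_even[of "s + 1"] False by simp
    qed
  qed
qed

text \<open>The same descent, stopping at 1 instead of a contradiction. The last position
  \<open>j = s - 1\<close> is left out of the hypothesis because the application to \<open>r\<close>
  does not supply it.\<close>

lemma thue_morse_prefix_antisquare:
  assumes "s > 0" and "\<And>j. Suc j < s \<Longrightarrow> thue_morse (s + j) = - thue_morse j"
  shows "\<exists>i. s = 2 ^ i"
  using assms
proof (induction s rule: less_induct)
  case (less s)
  have t2: "thue_morse 2 = - 1" using thue_morse_double[of 1] by simp
  have t3: "thue_morse 3 = 1" using thue_morse_Suc_double[of 1] by (simp add: eval_nat_numeral)
  show ?case
  proof (cases "even s")
    case True
    then obtain u where u: "s = 2 * u" by blast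
    have "\<exists>i. u = 2 ^ i"
    proof (rule less.IH)
      show "u < s" "u > 0" using u less.prems by auto
      show "thue_morse (u + j) = - thue_morse j" if "Suc j < u" for j
        using less.prems(2)[of "2 * j"] that u thue_morse_double[of "u + j"]
        by (simp add: distrib_left)
    qed
    then show ?thesis using u by (metis power_Suc)
  next
    case False
    consider "s = 1" | "s = 3" | "s > 3" using False by atomize_elim presburger
    then show ?thesis
    proof cases
      case 1
      then show ?thesis by (metis power_0)
    next
      case 2
      then show ?thesis using less.prems(2)[of 0] t3 by simp
    next
      case 3
      have "thue_morse (s + 1) = 1" "thue_morse (s + 2) = 1"
        using less.prems(2)[of 1] less.prems(2)[of 2] 3 t2 by auto
      then show ?thesis using thue_morse_Suc_even[of "s + 1"] False by simp
    qed
  qed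
qed


subsection \<open>Generating polynomials\<close>

definition gen_poly :: "nat set \<Rightarrow> int poly" where
  "gen_poly S = (\<Sum>s\<in>S. monom 1 s)"

lemma coeff_gen_poly: "finite S \<Longrightarrow> coeff (gen_poly S) n = of_bool (n \<in> S)"
  by (simp add: gen_poly_def coeff_sum of_bool_def sum.delta)

lemma gen_poly_Un_disjoint:
  "finite S \<Longrightarrow> finite T \<Longrightarrow> S \<inter> T = {} \<Longrightarrow> gen_poly (S \<union> T) = gen_poly S + gen_poly T"
  by (simp add: gen_poly_def sum.union_disjoint)

lemma finite_translate: "finite S \<Longrightarrow> finite (translate a S)"
  by (simp add: translate_def)

lemma gen_poly_translate: "gen_poly (translate a S) = monom 1 a * gen_poly S"
proof -
  have "translate a S = (+) a ` S" by (auto simp: translate_def)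
  then show ?thesis
    by (simp add: gen_poly_def sum.reindex sum_distrib_left mult_monom)
qed

lemma pcompose_monom_square: "pcompose (monom (1::int) n) (monom 1 2) = monom 1 (2 * n)"
  by (induction n) (simp_all add: monom_Suc pcompose_pCons monom_0 mult_monom numeral_2_eq_2 one_pCons)

lemma pcompose_gen_poly: "pcompose (gen_poly S) (monom 1 2) = gen_poly ((*) 2 ` S)"
  by (simp add: gen_poly_def pcompose_sum pcompose_monom_square sum.reindex inj_on_def)

lemma coeff_pcompose_gen_poly:
  assumes "finite S"
  shows "coeff (pcompose (gen_poly S) (monom 1 2)) n = of_bool (even n \<and> n div 2 \<in> S)"
proof -
  have "n \<in> (*) 2 ` S \<longleftrightarrow> even n \<and> n div 2 \<in> S" by auto
  then show ?thesis using assms by (simp add: pcompose_gen_poly coeff_gen_poly)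
qed

text \<open>The square counts ordered pairs: each pair of distinct summands twice, and the diagonal
  \<open>s = s'\<close> once, which is the coefficient of the polynomial at z^2.\<close>

lemma coeff_gen_poly_square:
  assumes "finite S"
  shows "coeff (gen_poly S * gen_poly S) n
    = 2 * int (rep_count S n) + coeff (pcompose (gen_poly S) (monom 1 2)) n"
proof -
  define X where "X = {i. i \<le> n \<and> i \<in> S \<and> n - i \<in> S}"
  have fin: "finite X" by (simp add: X_def)
  have "coeff (gen_poly S * gen_poly S) n = (\<Sum>i\<le>n. of_bool (i \<in> S \<and> n - i \<in> S))"
    using assms by (simp add: coeff_mult coeff_gen_poly of_bool_conj)
  also have "\<dots> = int (card ({..n} \<inter> {i. i \<in> S \<and> n - i \<in> S}))"
    by (subst sum_of_bool_eq) auto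
  also have "{..n} \<inter> {i. i \<in> S \<and> n - i \<in> S} = X"
    by (auto simp: X_def)
  also have "X = {i \<in> X. 2 * i < n} \<union> ({i \<in> X. 2 * i > n} \<union> {i \<in> X. 2 * i = n})"
    by auto
  also have "card \<dots> = card {i \<in> X. 2 * i < n} + (card {i \<in> X. 2 * i > n} + card {i \<in> X. 2 * i = n})"
    using fin by (subst card_Un_disjoint, auto)+
  also have "card {i \<in> X. 2 * i < n} = rep_count S n"
    unfolding rep_count_def
    by (rule bij_betw_same_card[of "\<lambda>i. (i, n - i)"], rule bij_betw_byWitness[where f' = fst])
       (auto simp: X_def)
  also have "card {i \<in> X. 2 * i > n} = rep_count S n"
    unfolding rep_count_def
    by (rule bij_betw_same_card[of "\<lambda>i. (n - i, i)"], rule bij_betw_byWitness[where f' = snd])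
       (auto simp: X_def)
  also have "{i \<in> X. 2 * i = n} = (if even n \<and> n div 2 \<in> S then {n div 2} else {})"
    by (auto simp: X_def)
  finally show ?thesis
    using assms by (simp add: coeff_pcompose_gen_poly)
qed

text \<open>Subtracting the square identities of \<open>C\<close> and \<open>D\<close> leaves twice
  the difference of the counts plus the diagonal part F(z^2).\<close>

lemma rep_count_eq_iff_gen_poly:
  assumes "finite C" "finite D"
  shows "(\<forall>n. rep_count C n = rep_count D n) \<longleftrightarrow>
    (gen_poly C - gen_poly D) * (gen_poly C + gen_poly D)
      = pcompose (gen_poly C - gen_poly D) (monom 1 2)"
proof -
  have "(gen_poly C - gen_poly D) * (gen_poly C + gen_poly D)
      = gen_poly C * gen_poly C - gen_poly D * gen_poly D"
    by (simp add: algebra_simps)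
  then show ?thesis
    using assms by (simp add: poly_eq_iff coeff_gen_poly_square pcompose_diff)
qed

lemma rep_count_0 [simp]: "rep_count S 0 = 0"
  unfolding rep_count_def by (subst card_eq_0_iff) auto

section \<open>Generating polynomials of the Thue-Morse blocks, and sufficiency\<close>

lemma mem_setA_upto: "n \<in> setA_upto k \<longleftrightarrow> n \<in> setA \<and> n < 2 ^ k"
proof -
  have "n \<le> 2 ^ k - 1 \<longleftrightarrow> n < 2 ^ k" using zero_less_power[of "2 :: nat" k] by linarith
  then show ?thesis by (simp add: setA_upto_def)
qed

lemma mem_setB_upto: "n \<in> setB_upto k \<longleftrightarrow> n \<notin> setA \<and> n < 2 ^ k"
proof -
  have "n \<le> 2 ^ k - 1 \<longleftrightarrow> n < 2 ^ k" using zero_less_power[of "2 :: nat" k] by linarith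
  then show ?thesis by (simp add: setB_upto_def setB_def)
qed

lemma mem_translate: "n \<in> translate a S \<longleftrightarrow> a \<le> n \<and> n - a \<in> S"
  by (force simp: translate_def)

text \<open>The digit \<open>2 ^ k\<close> swaps the classes, so each new block is the old one
  together with the translate of the opposite one. Iterating gives the product formulas for
  difference and sum.\<close>

lemma gen_poly_upto_Suc:
  "gen_poly (setA_upto (Suc k)) - gen_poly (setB_upto (Suc k))
    = (gen_poly (setA_upto k) - gen_poly (setB_upto k)) * (1 - monom 1 (2 ^ k))" (is ?diff)
  "gen_poly (setA_upto (Suc k)) + gen_poly (setB_upto (Suc k))
    = (gen_poly (setA_upto k) + gen_poly (setB_upto k)) * (1 + monom 1 (2 ^ k))" (is ?sum)
proof -
  have flip: "2 ^ k + n \<in> setA \<longleftrightarrow> n \<notin> setA" if "n < 2 ^ k" for n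
    using thue_morse_add_power[OF that] by (auto simp: thue_morse_def split: if_splits)
  have shift: "x \<in> setA \<longleftrightarrow> x - 2 ^ k \<notin> setA" if "2 ^ k \<le> x" "x < 2 ^ Suc k" for x
    using flip[of "x - 2 ^ k"] that by auto
  have A: "setA_upto (Suc k) = setA_upto k \<union> translate (2 ^ k) (setB_upto k)"
  proof (rule set_eqI)
    fix x show "x \<in> setA_upto (Suc k) \<longleftrightarrow> x \<in> setA_upto k \<union> translate (2 ^ k) (setB_upto k)"
      using shift[of x] by (cases "x < 2 ^ k"; cases "x < 2 ^ Suc k")
        (simp_all add: mem_setA_upto mem_setB_upto mem_translate, linarith+)
  qed
  have B: "setB_upto (Suc k) = setB_upto k \<union> translate (2 ^ k) (setA_upto k)"
  proof (rule set_eqI)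
    fix x show "x \<in> setB_upto (Suc k) \<longleftrightarrow> x \<in> setB_upto k \<union> translate (2 ^ k) (setA_upto k)"
      using shift[of x] by (cases "x < 2 ^ k"; cases "x < 2 ^ Suc k")
        (simp_all add: mem_setA_upto mem_setB_upto mem_translate, linarith+)
  qed
  have fin: "finite (setA_upto k)" "finite (setB_upto k)"
    by (simp_all add: setA_upto_def setB_upto_def)
  have disj: "setA_upto k \<inter> translate (2 ^ k) (setB_upto k) = {}"
    "setB_upto k \<inter> translate (2 ^ k) (setA_upto k) = {}"
    by (auto simp: mem_setA_upto mem_setB_upto mem_translate)
  show ?diff ?sum
    using fin disj
    by (simp_all add: A B gen_poly_Un_disjoint finite_translate gen_poly_translate algebra_simps)
qed

lemma gen_poly_upto_0: "gen_poly (setA_upto 0) = 1" "gen_poly (setB_upto 0) = 0"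
proof -
  have "setA_upto 0 = {0}" "setB_upto 0 = {}"
    using thue_morse_0 by (auto simp: setA_upto_def setB_upto_def setB_def thue_morse_def split: if_splits)
  then show "gen_poly (setA_upto 0) = 1" "gen_poly (setB_upto 0) = 0"
    by (simp_all add: gen_poly_def)
qed

lemma gen_poly_upto_sum:
  "(gen_poly (setA_upto k) + gen_poly (setB_upto k)) * (1 - monom 1 1) = 1 - monom 1 (2 ^ k)"
proof (induction k)
  case (Suc k)
  have "(gen_poly (setA_upto (Suc k)) + gen_poly (setB_upto (Suc k))) * (1 - monom 1 1)
    = (1 - monom 1 (2 ^ k)) * (1 + monom 1 (2 ^ k))"
    by (subst gen_poly_upto_Suc(2)) (simp add: Suc.IH[symmetric] mult.assoc mult.left_commute mult.commute)
  then show ?case by (simp add: algebra_simps mult_monom flip: mult_2)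
qed (simp add: gen_poly_upto_0)

text \<open>Substituting z^2 in the product of the 1 - z^(2^i) moves every factor to the next: 1 - z
  is lost and 1 - z^(2^k) is gained.\<close>

lemma gen_poly_upto_diff_square:
  "pcompose (gen_poly (setA_upto k) - gen_poly (setB_upto k)) (monom 1 2) * (1 - monom 1 1)
    = (gen_poly (setA_upto k) - gen_poly (setB_upto k)) * (1 - monom 1 (2 ^ k))"
proof (induction k)
  case (Suc k)
  let ?T = "\<lambda>k. gen_poly (setA_upto k) - gen_poly (setB_upto k)"
  have "pcompose (?T (Suc k)) (monom 1 2) * (1 - monom 1 1)
    = (pcompose (?T k) (monom 1 2) * (1 - monom 1 1)) * (1 - monom 1 (2 ^ Suc k))"
    unfolding gen_poly_upto_Suc(1) pcompose_mult
    by (simp add: pcompose_diff pcompose_1 pcompose_monom_square mult.assoc mult.commute mult.left_commute)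
  also have "\<dots> = ?T (Suc k) * (1 - monom 1 (2 ^ Suc k))"
    by (simp only: Suc.IH gen_poly_upto_Suc(1))
  finally show ?case .
qed (simp add: gen_poly_upto_0 pcompose_1)

lemma two_power_minus_1_in_setA: "2 ^ (2 * l) - 1 \<in> setA"
  using thue_morse_power_minus_1[of "2 * l"] by (auto simp: thue_morse_def split: if_splits)

lemma zero_in_setA: "0 \<in> setA"
  using thue_morse_0 by (auto simp: thue_morse_def split: if_splits)

lemma rep_count_thue_morse_blocks:
  "rep_count (setA_upto (2 * l) \<union> translate (2 ^ (2 * l) - 1) (setB_upto (2 * l))) n
    = rep_count (setB_upto (2 * l) \<union> translate (2 ^ (2 * l) - 1) (setA_upto (2 * l))) n"
proof -
  define N where "N = (2::nat) ^ (2 * l)"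
  define P where "P = gen_poly (setA_upto (2 * l))"
  define Q where "Q = gen_poly (setB_upto (2 * l))"
  define z :: "nat \<Rightarrow> int poly" where "z = monom 1"
  define C where "C = setA_upto (2 * l) \<union> translate (N - 1) (setB_upto (2 * l))"
  define D where "D = setB_upto (2 * l) \<union> translate (N - 1) (setA_upto (2 * l))"
  have N: "N > 0" by (simp add: N_def)
  have fin: "finite (setA_upto (2 * l))" "finite (setB_upto (2 * l))"
    by (simp_all add: setA_upto_def setB_upto_def)
  \<comment> \<open>The blocks can meet only at \<open>N - 1\<close>. Both \<open>N - 1\<close> (as
    \<open>2 * l\<close> is even) and 0 lie in \<open>setA\<close>, so neither union has an overlap
    there.\<close>
  have disj: "setA_upto (2 * l) \<inter> translate (N - 1) (setB_upto (2 * l)) = {}"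
    "setB_upto (2 * l) \<inter> translate (N - 1) (setA_upto (2 * l)) = {}"
    using two_power_minus_1_in_setA[of l] zero_in_setA
    by (auto simp: setA_upto_def setB_upto_def setB_def translate_def simp flip: N_def)
  have C: "gen_poly C = P + z (N - 1) * Q" and D: "gen_poly D = Q + z (N - 1) * P"
    using fin disj by (simp_all add: C_def D_def P_def Q_def z_def gen_poly_Un_disjoint
        finite_translate gen_poly_translate)
  have diff: "gen_poly C - gen_poly D = (P - Q) * (1 - z (N - 1))"
    and sum: "gen_poly C + gen_poly D = (P + Q) * (1 + z (N - 1))"
    by (simp_all add: C D algebra_simps)
  have zz: "pcompose (1 - z (N - 1)) (monom 1 2) = (1 - z (N - 1)) * (1 + z (N - 1))"
    by (simp add: z_def pcompose_diff pcompose_1 pcompose_monom_square algebra_simps mult_monom flip: mult_2)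
  note sum_eq = gen_poly_upto_sum[of "2 * l", folded P_def Q_def N_def]
  note diff_eq = gen_poly_upto_diff_square[of "2 * l", folded P_def Q_def N_def]
  \<comment> \<open>The factor 1 - z makes the sum and the difference telescope; it is nonzero and
    is cancelled at the end.\<close>
  have "((gen_poly C - gen_poly D) * (gen_poly C + gen_poly D)) * (1 - monom 1 1)
    = (P - Q) * (1 - z (N - 1)) * (1 + z (N - 1)) * ((P + Q) * (1 - monom 1 1))"
    by (simp only: diff sum mult_ac)
  also have "\<dots> = ((P - Q) * (1 - monom 1 N)) * ((1 - z (N - 1)) * (1 + z (N - 1)))"
    unfolding sum_eq by (simp only: mult_ac)
  also have "\<dots> = pcompose (gen_poly C - gen_poly D) (monom 1 2) * (1 - monom 1 1)"
    unfolding diff pcompose_mult zz diff_eq[symmetric]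
    by (simp only: mult_ac)
  finally have "((gen_poly C - gen_poly D) * (gen_poly C + gen_poly D)) * (1 - monom 1 1)
    = pcompose (gen_poly C - gen_poly D) (monom 1 2) * (1 - monom 1 1)" .
  moreover have "1 - monom (1::int) 1 \<noteq> 0"
    by (auto simp: poly_eq_iff intro!: exI[of _ 0])
  ultimately have "(gen_poly C - gen_poly D) * (gen_poly C + gen_poly D)
    = pcompose (gen_poly C - gen_poly D) (monom 1 2)"
    using mult_right_cancel by blast
  then have "\<forall>n. rep_count C n = rep_count D n"
    by (subst rep_count_eq_iff_gen_poly) (auto simp: C_def D_def fin finite_translate)
  then show ?thesis by (simp add: C_def D_def N_def)
qed


subsection \<open>The coefficient recurrence\<close>

text \<open>The strict bounds on \<open>r\<close> set aside the boundary positions, which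
  \<open>theorem7\<close> treats separately.\<close>

locale equal_reps =
  fixes m r :: nat and C D :: "nat set"
  assumes Un_eq: "C \<union> D = {0..m}" and Int_eq: "C \<inter> D = {r}" and zero_in_C: "0 \<in> C"
    and r_pos: "0 < r" and r_less: "r < m" and rep_count_eq: "rep_count C n = rep_count D n"
begin

text \<open>These are the coefficients of F: 0 at \<open>r\<close> and above \<open>m\<close>, and 1
  or -1 elsewhere.\<close>

definition f :: "nat \<Rightarrow> int" where
  "f n = of_bool (n \<in> C) - of_bool (n \<in> D)"

text \<open>The coefficients of F(z^2) and of z^r F(z), respectively.\<close>

definition half :: "nat \<Rightarrow> int" where
  "half n = (if even n then f (n div 2) else 0)"

definition shifted :: "nat \<Rightarrow> int" where
  "shifted n = (if r \<le> n then f (n - r) else 0)"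

lemma finite_CD: "finite C" "finite D"
  using Un_eq by (metis finite_Un finite_atLeastAtMost)+

lemma f_r [simp]: "f r = 0"
  using Int_eq by (auto simp: f_def)

lemma f_0 [simp]: "f 0 = 1"
  using zero_in_C Int_eq r_pos by (auto simp: f_def)

lemma f_cases: "n \<le> m \<Longrightarrow> n \<noteq> r \<Longrightarrow> f n = 1 \<or> f n = - 1"
  using Un_eq Int_eq by (auto simp: f_def)

text \<open>For \<open>n \<le> m\<close> the factor 1 + z + ... + z^m contributes the full partial
  sum, and the extra z^r contributes \<open>shifted n\<close>.\<close>

lemma sum_f:
  assumes "n \<le> m"
  shows "(\<Sum>i\<le>n. f i) + shifted n = half n"
proof -
  have prod: "(gen_poly C - gen_poly D) * (gen_poly C + gen_poly D)
      = pcompose (gen_poly C - gen_poly D) (monom 1 2)"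
    using rep_count_eq by (subst rep_count_eq_iff_gen_poly[symmetric]) (simp_all add: finite_CD)
  have sum: "coeff (gen_poly C + gen_poly D) k = of_bool (k \<le> m) + of_bool (k = r)" for k
    using Un_eq Int_eq by (auto simp: coeff_gen_poly finite_CD of_bool_def)
  have "half n = coeff (pcompose (gen_poly C - gen_poly D) (monom 1 2)) n"
    by (simp add: half_def pcompose_diff coeff_pcompose_gen_poly finite_CD f_def)
  also have "\<dots> = coeff ((gen_poly C - gen_poly D) * (gen_poly C + gen_poly D)) n"
    by (simp only: prod)
  also have "\<dots> = (\<Sum>i\<le>n. f i * (of_bool (n - i \<le> m) + of_bool (n - i = r)))"
    by (simp only: coeff_mult sum) (simp add: coeff_gen_poly finite_CD f_def)
  \<comment> \<open>If \<open>n < r\<close>, the truncated \<open>n - r\<close> is 0, but then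
    \<open>shifted n\<close> is 0 as well.\<close>
  also have "\<dots> = (\<Sum>i\<le>n. f i + (if i = n - r then shifted n else 0))"
    using assms by (intro sum.cong) (auto simp: shifted_def)
  also have "\<dots> = (\<Sum>i\<le>n. f i) + shifted n"
    by (simp add: sum.distrib)
  finally show ?thesis by simp
qed

lemma f_Suc:
  assumes "Suc n \<le> m"
  shows "f (Suc n) = half (Suc n) - half n - shifted (Suc n) + shifted n"
  using sum_f[of n] sum_f[of "Suc n"] assms by simp

section \<open>Thue-Morse values of \<open>f\<close> and the shape of \<open>r\<close>\<close>

lemma half_Suc_diff: "half (Suc n) - half n = (if odd n then f (Suc n div 2) else - f (n div 2))"
  by (simp add: half_def)

text \<open>\<open>half\<close> vanishes at odd arguments, so its differences obey the doubling
  rules of the Thue-Morse sequence. Only values of \<open>f\<close> up to half of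
  \<open>Suc n\<close> enter.\<close>

lemma half_Suc_diff_thue_morse:
  assumes "\<And>j. 2 * j \<le> Suc n \<Longrightarrow> f j = thue_morse j"
  shows "half (Suc n) - half n = thue_morse (Suc n)"
proof (cases "even n")
  case True
  then obtain j where "n = 2 * j" by blast
  then show ?thesis using assms[of j] by (simp add: half_Suc_diff)
next
  case False
  then obtain j where j: "Suc n = 2 * j" by (metis even_Suc evenE)
  then show ?thesis using assms[of j] False by (simp add: half_def)
qed

lemma f_below: "n < r \<Longrightarrow> f n = thue_morse n"
proof (induction n rule: less_induct)
  case (less n)
  show ?case
  proof (cases n)
    case (Suc k)
    have "half (Suc k) - half k = thue_morse (Suc k)"
      using less Suc by (intro half_Suc_diff_thue_morse) auto
    then show ?thesis using f_Suc[of k] less.prems Suc r_less by (simp add: shifted_def)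
  qed simp
qed

text \<open>At \<open>r\<close> the recurrence first subtracts \<open>f 0 = 1\<close>, and the
  result has to be \<open>f r = 0\<close>.\<close>

lemma thue_morse_r: "thue_morse r = 1"
proof -
  obtain k where k: "Suc k = r" using r_pos by (cases r) auto
  have "half (Suc k) - half k = thue_morse (Suc k)"
    using k by (intro half_Suc_diff_thue_morse f_below) auto
  moreover have "shifted (Suc k) = 1" "shifted k = 0" using k by (auto simp: shifted_def)
  ultimately show ?thesis using f_Suc[of k] k r_less by simp
qed

text \<open>As \<open>k < r\<close>, \<open>half\<close> still reads only indices below
  \<open>r\<close>, where \<open>f\<close> is Thue-Morse.\<close>

lemma f_shift:
  assumes "0 < k" "k < r" "r + k \<le> m"
  shows "f (r + k) = thue_morse (r + k) - thue_morse k + thue_morse (k - 1)"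
proof -
  obtain j where j: "k = Suc j" using assms by (cases k) auto
  have "half (Suc (r + j)) - half (r + j) = thue_morse (Suc (r + j))"
    using assms j by (intro half_Suc_diff_thue_morse f_below) auto
  moreover have "shifted (r + j) = thue_morse j" "shifted (Suc (r + j)) = thue_morse k"
    using assms j f_below[of j] f_below[of k] by (auto simp: shifted_def)
  ultimately show ?thesis using f_Suc[of "r + j"] assms j by simp
qed

lemma f_Suc_r:
  assumes "1 < r"
  shows "f (Suc r) = 1"
proof -
  have "f (Suc r) = thue_morse (Suc r) + 2"
    using f_shift[of 1] assms r_less by simp
  then show ?thesis using f_cases[of "Suc r"] r_less thue_morse_cases[of "Suc r"] by auto
qed

text \<open>For odd \<open>k\<close>, \<open>f_shift\<close> reads t(r + k) - 2 t(k), which is 1 or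
  -1 only if the two signs agree.\<close>

lemma thue_morse_shift_odd:
  assumes "odd k" "k < r" "r + k \<le> m"
  shows "thue_morse (r + k) = thue_morse k"
proof -
  have k: "0 < k" using assms by (auto intro: odd_pos)
  have "thue_morse (k - 1) = - thue_morse k"
    using thue_morse_Suc_even[of "k - 1"] assms k by auto
  then show ?thesis
    using f_shift[OF k assms(2,3)] f_cases[of "r + k"] assms k
      thue_morse_cases[of k] thue_morse_cases[of "r + k"] by auto
qed

text \<open>For even \<open>r\<close> the pairs of an even number and its successor stay aligned
  under the shift, so agreement at odd \<open>k\<close> spreads to all \<open>k < r\<close> and
  yields a prefix square.\<close>

lemma odd_r:
  assumes "2 * r \<le> m"
  shows "odd r"
proof
  assume even: "even r"
  have "thue_morse (r + k) = thue_morse k" if "k < r" for k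
  proof (cases "odd k")
    case True
    then show ?thesis using thue_morse_shift_odd that assms by simp
  next
    case False
    then have "Suc k < r" using that even by (metis Suc_lessI even_Suc)
    then have "thue_morse (Suc (r + k)) = thue_morse (Suc k)"
      using thue_morse_shift_odd[of "Suc k"] False assms by simp
    then show ?thesis using thue_morse_Suc_even[of "r + k"] thue_morse_Suc_even[of k] even False
      by simp
  qed
  then show False using thue_morse_no_prefix_square r_pos by blast
qed

lemma r_eq_power:
  assumes "2 * r \<le> m"
  shows "\<exists>l>0. r = 2 ^ (2 * l) - 1"
proof -
  obtain q where q: "r = Suc (2 * q)" using odd_r[OF assms] by (metis oddE Suc_eq_plus1)
  have "\<exists>i. Suc q = 2 ^ i"
  proof (rule thue_morse_prefix_antisquare)
    fix j assume "Suc j < Suc q"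
    \<comment> \<open>With \<open>r = Suc (2 * q)\<close> and \<open>k = Suc (2 * j)\<close>, the
      shifted index \<open>r + k\<close> is even, and halving it gives an antisquare of period
      \<open>Suc q\<close>.\<close>
    then have "thue_morse (2 * (Suc q + j)) = thue_morse (Suc (2 * j))"
      using thue_morse_shift_odd[of "Suc (2 * j)"] q assms by (simp add: algebra_simps)
    then show "thue_morse (Suc q + j) = - thue_morse j"
      by (simp only: thue_morse_double thue_morse_Suc_double)
  qed simp
  then obtain i where "Suc q = 2 ^ i" by blast
  then have r: "r = 2 ^ Suc i - 1" using q by simp
  \<comment> \<open>\<open>r\<close> has exactly \<open>Suc i\<close> digits, all equal to 1, and
    \<open>thue_morse_r\<close> fixes their parity.\<close>
  have "even (Suc i)"
    using thue_morse_r thue_morse_power_minus_1[of "Suc i"]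
    by (cases "even (Suc i)") (simp_all add: r del: power_Suc)
  then obtain l where "Suc i = 2 * l" by blast
  then show ?thesis using r by (intro exI[of _ l]) auto
qed

section \<open>Values of \<open>f\<close> beyond \<open>r\<close> when \<open>Suc r\<close> is a
  power of four\<close>

context
  fixes l
  assumes l_pos: "0 < l" and r_power: "r = 2 ^ (2 * l) - 1" and twice_r_le: "2 * r \<le> m"
begin

lemma Suc_r: "Suc r = 2 ^ (2 * l)"
  using r_power by simp

lemma r_ge_3: "3 \<le> r"
proof -
  have "(2::nat) ^ 2 \<le> 2 ^ (2 * l)" using l_pos by (intro power_increasing) auto
  then show ?thesis using r_power by simp
qed

text \<open>Here t(r + k) = -t(k - 1), which cancels the last term of
  \<open>f_shift\<close>.\<close>

lemma f_second_block_below: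
  assumes "0 < k" "k < r"
  shows "f (r + k) = - thue_morse k"
proof -
  have "r + k = 2 ^ (2 * l) + (k - 1)" using assms Suc_r by simp
  then have "thue_morse (r + k) = - thue_morse (k - 1)"
    using thue_morse_add_power[of "k - 1" "2 * l"] assms Suc_r by simp
  then show ?thesis using f_shift[of k] assms twice_r_le by simp
qed

lemma thue_morse_pred_r: "thue_morse (r - 1) = - 1"
  using thue_morse_Suc_even[of "r - 1"] odd_r[OF twice_r_le] r_pos thue_morse_r by simp

lemma f_second_block:
  assumes "0 < k" "k \<le> r"
  shows "f (r + k) = - thue_morse k"
proof (cases "k < r")
  case True
  then show ?thesis using f_second_block_below assms by blast
next
  case False
  then have k: "k = r" using assms by simp
  \<comment> \<open>At \<open>k = r\<close> both \<open>half (2 * r)\<close> and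
    \<open>shifted (2 * r)\<close> are \<open>f r = 0\<close>, so only
    \<open>shifted n = f (r - 1)\<close> survives.\<close>
  define n where "n = 2 * r - 1"
  have n: "Suc n = 2 * r" "n - r = r - 1" "r \<le> n" "odd n" using r_pos by (auto simp: n_def)
  have "f (Suc n) = half (Suc n) - half n - shifted (Suc n) + shifted n"
    using n twice_r_le by (intro f_Suc) simp
  moreover have "shifted n = - 1"
    using n f_below[of "r - 1"] thue_morse_pred_r r_pos by (simp add: shifted_def)
  moreover have "shifted (Suc n) = 0" using n by (simp add: shifted_def)
  moreover have "half (Suc n) - half n = 0" using n by (simp add: half_def)
  ultimately show ?thesis using k n thue_morse_r by (simp add: mult_2)
qed

text \<open>Both \<open>half\<close> and \<open>shifted\<close> now read the second block: the
  former contributes -t(k), the latter t(k) - t(k - 1).\<close>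

lemma f_third_block:
  assumes "0 < k" "k \<le> r" "2 * r + k \<le> m"
  shows "f (2 * r + k) = - thue_morse (k - 1)"
proof -
  obtain j where j: "k = Suc j" using assms by (cases k) auto
  have step: "f (2 * r + k)
      = half (Suc (2 * r + j)) - half (2 * r + j) - shifted (2 * r + k) + shifted (2 * r + j)"
    using f_Suc[of "2 * r + j"] assms j by simp
  have sh: "shifted (2 * r + i) = f (r + i)" for i by (simp add: shifted_def mult_2)
  show ?thesis
  \<comment> \<open>For \<open>j = 0\<close> the exceptional value \<open>f r = 0\<close> is read by
    both \<open>half\<close> and \<open>shifted\<close>.\<close>
  proof (cases "j = 0")
    case True
    then show ?thesis
      using step j f_second_block[of 1] r_pos sh[of 0] sh[of 1] by (simp add: half_Suc_diff)
  next
    case False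
    have "half (Suc (2 * r + j)) - half (2 * r + j) = - thue_morse k"
    proof (cases "even j")
      case True
      then obtain i where "j = 2 * i" by blast
      then show ?thesis using f_second_block[of i] False assms j by (simp add: half_Suc_diff)
    next
      case odd: False
      then obtain i where i: "Suc j = 2 * i" by (metis even_Suc evenE)
      then have "Suc (2 * r + j) = 2 * (r + i)" by simp
      then have "Suc (2 * r + j) div 2 = r + i" by (simp only:) simp
      then have "half (Suc (2 * r + j)) - half (2 * r + j) = f (r + i)"
        using odd by (simp only: half_Suc_diff) simp
      then show ?thesis using f_second_block[of i] assms j i by simp
    qed
    then show ?thesis
      using step False j assms f_second_block[of k] f_second_block[of j] sh[of k] sh[of j] by simp
  qed
qed

text \<open>Half of \<open>3 * r + 1\<close> is \<open>r + 2 ^ (2 * l - 1)\<close>, and a power of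
  two has a single digit 1.\<close>

lemma half_3r_1: "half (3 * r + 1) = 1"
proof -
  define e where "e = 2 * l - 1"
  have "Suc r = 2 * 2 ^ e" using Suc_r l_pos by (simp add: e_def flip: power_Suc)
  then have e: "3 * r + 1 = 2 * (r + 2 ^ e)" "2 ^ e \<le> r" using r_ge_3 by auto
  then have "half (3 * r + 1) = f (r + 2 ^ e)" unfolding half_def by (simp only:) simp
  then show ?thesis
    using f_second_block[of "2 ^ e"] e thue_morse_add_power[of 0 e] by simp
qed

lemma f_3r_1:
  assumes "3 * r + 1 \<le> m"
  shows "f (3 * r + 1) = 1"
proof -
  have "half (Suc (3 * r)) - half (3 * r) = 1"
    using half_3r_1 odd_r[OF twice_r_le] by (simp add: half_def)
  moreover have "shifted (Suc (3 * r)) = f (2 * r + 1)" "shifted (3 * r) = f (r + r)"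
    by (simp_all add: shifted_def mult_2 Suc_diff_le)
  moreover have "f (2 * r + 1) = - 1" "f (r + r) = - 1"
    using f_third_block[of 1] f_second_block[of r] r_pos assms thue_morse_r by simp_all
  ultimately show ?thesis using f_Suc[of "3 * r"] assms by simp
qed

text \<open>One step past \<open>3 * r + 1\<close> all three nonzero terms of the recurrence are -1,
  so \<open>f\<close> would be -3.\<close>

lemma m_le: "m \<le> 3 * r + 1"
proof (rule ccontr)
  assume "\<not> m \<le> 3 * r + 1"
  then have m: "Suc (3 * r + 1) \<le> m" by simp
  have "half (Suc (3 * r + 1)) - half (3 * r + 1) = - 1"
    using half_3r_1 odd_r[OF twice_r_le] by (simp add: half_def)
  moreover have "shifted (Suc (3 * r + 1)) = f (2 * r + 2)" "shifted (3 * r + 1) = f (2 * r + 1)"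
    by (simp_all add: shifted_def mult_2 Suc_diff_le)
  moreover have "f (2 * r + 1) = - 1" "f (2 * r + 2) = 1"
    using f_third_block[of 1] f_third_block[of 2] r_ge_3 m by simp_all
  ultimately have "f (Suc (3 * r + 1)) = - 3" using f_Suc[of "3 * r + 1"] m by simp
  then show False using f_cases[OF m] by simp
qed

end

end

subsection \<open>Reflection\<close>

lemma mem_reflect:
  fixes m :: nat
  assumes "S \<subseteq> {0..m}"
  shows "x \<in> (\<lambda>x. m - x) ` S \<longleftrightarrow> x \<le> m \<and> m - x \<in> S"
  using assms by (force simp: image_iff)

text \<open>Reflection reverses order, so a pair is also swapped; its sum \<open>n\<close> becomes
  \<open>2 * m - n\<close>.\<close>

lemma rep_count_reflect:
  assumes S: "S \<subseteq> {0..m}"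
  shows "rep_count ((\<lambda>x. m - x) ` S) n = (if n \<le> 2 * m then rep_count S (2 * m - n) else 0)"
proof (cases "n \<le> 2 * m")
  case True
  have le: "x \<le> m" if "x \<in> S" for x using S that by auto
  then have reflect_twice: "m - (m - x) = x" if "x \<in> S" for x using that by simp
  have "bij_betw (\<lambda>(s, s'). (m - s', m - s))
      {(s, s'). s \<in> S \<and> s' \<in> S \<and> s < s' \<and> s + s' = 2 * m - n}
      {(s, s'). s \<in> (\<lambda>x. m - x) ` S \<and> s' \<in> (\<lambda>x. m - x) ` S \<and> s < s' \<and> s + s' = n}"
    unfolding mem_reflect[OF S]
    by (rule bij_betw_byWitness[where f' = "\<lambda>(s, s'). (m - s', m - s)"])
       (use True in \<open>auto simp: reflect_twice dest: le\<close>)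
  then show ?thesis using True unfolding rep_count_def by (simp add: bij_betw_same_card)
next
  case False
  then have empty: "{(s, s'). s \<in> (\<lambda>x. m - x) ` S \<and> s' \<in> (\<lambda>x. m - x) ` S \<and> s < s' \<and> s + s' = n} = {}"
    by auto
  show ?thesis using False unfolding rep_count_def empty by simp
qed

context equal_reps
begin

abbreviation reflect :: "nat set \<Rightarrow> nat set" where
  "reflect S \<equiv> (\<lambda>x. m - x) ` S"

lemma CD_subset: "C \<subseteq> {0..m}" "D \<subseteq> {0..m}"
  using Un_eq by auto

text \<open>The set containing \<open>m\<close> must come first, since its reflection is the one
  that contains 0.\<close>

lemma reflect_equal_reps:
  "m \<in> C \<Longrightarrow> equal_reps m (m - r) (reflect C) (reflect D)"
  "m \<in> D \<Longrightarrow> equal_reps m (m - r) (reflect D) (reflect C)"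
proof -
  have U: "reflect C \<union> reflect D = {0..m}"
  proof (rule set_eqI)
    fix x
    have "m - x \<in> C \<union> D" using Un_eq by simp
    then show "x \<in> reflect C \<union> reflect D \<longleftrightarrow> x \<in> {0..m}"
      by (auto simp: mem_reflect CD_subset)
  qed
  have I: "reflect C \<inter> reflect D = {m - r}"
  proof (rule set_eqI)
    fix x
    have "m - x \<in> C \<inter> D \<longleftrightarrow> m - x = r" using Int_eq by simp
    then show "x \<in> reflect C \<inter> reflect D \<longleftrightarrow> x \<in> {m - r}"
      using r_less by (auto simp: mem_reflect CD_subset)
  qed
  have E: "rep_count (reflect C) n = rep_count (reflect D) n" for n
    by (simp add: rep_count_reflect CD_subset rep_count_eq)
  show "equal_reps m (m - r) (reflect C) (reflect D)" if "m \<in> C"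
    using U I E r_pos r_less that by unfold_locales (auto simp: mem_reflect CD_subset)
  show "equal_reps m (m - r) (reflect D) (reflect C)" if "m \<in> D"
    using U I E r_pos r_less that
    by unfold_locales (auto simp: mem_reflect CD_subset Un_commute Int_commute)
qed

section \<open>Determination of \<open>m\<close> and of the two sets\<close>

lemma m_in_CD: "m \<in> C \<or> m \<in> D"
  using Un_eq by auto

lemma thue_morse_reflect: "thue_morse (m - r) = 1"
  using m_in_CD reflect_equal_reps equal_reps.thue_morse_r by blast

lemma m_eq_twice_r:
  assumes "2 * r \<le> m"
  shows "m = 2 * r"
proof (rule ccontr)
  assume "m \<noteq> 2 * r"
  then obtain c where c: "m = 2 * r + c" "0 < c"
    using assms by (metis add.right_neutral gr0I le_Suc_ex)
  obtain l where l: "0 < l" "r = 2 ^ (2 * l) - 1" using r_eq_power[OF assms] by blast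
  note l = l assms
  have r3: "3 \<le> r" using r_ge_3[OF l] .
  have "m \<notin> C"
  proof
    assume mC: "m \<in> C"
    interpret R: equal_reps m "m - r" "reflect C" "reflect D"
      by (rule reflect_equal_reps(1)[OF mC])
    \<comment> \<open>Reflection carries the place just after \<open>m - r\<close> to the one just
      before \<open>r\<close>. \<open>f\<close> is -1 there, while \<open>f_Suc_r\<close> for the
      reflected problem demands 1.\<close>
    have "Suc (m - r) \<le> m" "m - Suc (m - r) = r - 1" using r_less r_pos by linarith+
    then have "R.f (Suc (m - r)) = f (r - 1)"
      by (simp add: R.f_def f_def mem_reflect CD_subset)
    also have "\<dots> = - 1"
      using f_below[of "r - 1"] thue_morse_pred_r[OF l] r_pos by simp
    finally show False using R.f_Suc_r r3 assms by simp
  qed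
  then have f_m: "f m = - 1" using m_in_CD by (simp add: f_def)
  have "c \<le> r + 1" using m_le[OF l] c by simp
  then consider "c = r + 1" | "c \<le> r" by linarith
  then show False
  proof cases
    case 1
    then show False using f_3r_1[OF l] f_m c by simp
  next
    case 2
    \<comment> \<open>Now \<open>f m = -1\<close> forces t(c - 1) = 1, hence t(m - r) = -1 through
      the top digit, against \<open>thue_morse_reflect\<close>.\<close>
    have "f m = - thue_morse (c - 1)" using f_third_block[OF l, of c] 2 c by simp
    then have "thue_morse (c - 1) = 1" using f_m by simp
    moreover have "m - r = 2 ^ (2 * l) + (c - 1)" using Suc_r[OF l] c by simp
    moreover have "c - 1 < 2 ^ (2 * l)" using 2 Suc_r[OF l] by linarith
    ultimately show False
      using thue_morse_reflect thue_morse_add_power[of "c - 1" "2 * l"] by simp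
  qed
qed

text \<open>Otherwise the reflected problem satisfies the assumption of \<open>m_eq_twice_r\<close>,
  and the equality it gives is symmetric under reflection.\<close>

lemma twice_r_le: "2 * r \<le> m"
proof (rule ccontr)
  assume "\<not> 2 * r \<le> m"
  then have "2 * (m - r) \<le> m" by simp
  then have "m = 2 * (m - r)"
    using m_in_CD reflect_equal_reps equal_reps.m_eq_twice_r by blast
  then show False using \<open>\<not> 2 * r \<le> m\<close> r_less by linarith
qed

lemma characterisation:
  "\<exists>l. C = setA_upto (2 * l) \<union> translate (2 ^ (2 * l) - 1) (setB_upto (2 * l)) \<and>
       D = setB_upto (2 * l) \<union> translate (2 ^ (2 * l) - 1) (setA_upto (2 * l))"
proof -
  obtain l where l: "0 < l" "r = 2 ^ (2 * l) - 1" using r_eq_power[OF twice_r_le] by blast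
  note l = l twice_r_le
  have m: "m = 2 * r" using m_eq_twice_r[OF twice_r_le] .
  have le: "n < 2 ^ (2 * l) \<longleftrightarrow> n \<le> r" for n using Suc_r[OF l] by (simp flip: less_Suc_eq_le)
  have rA: "r \<in> setA" using two_power_minus_1_in_setA l by simp
  have "(x \<in> C \<longleftrightarrow> x \<in> setA_upto (2 * l) \<union> translate r (setB_upto (2 * l))) \<and>
        (x \<in> D \<longleftrightarrow> x \<in> setB_upto (2 * l) \<union> translate r (setA_upto (2 * l)))" for x
  proof -
    consider "x < r" | "x = r" | "r < x" "x \<le> m" | "m < x" by linarith
    then show ?thesis
    proof cases
      case 1
      then show ?thesis
        using f_below[of x] by (auto simp: f_def thue_morse_def mem_setA_upto mem_setB_upto
            mem_translate le of_bool_def split: if_splits)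
    next
      case 2
      then show ?thesis
        \<comment> \<open>\<open>r\<close> enters the first set through \<open>r\<close> in
          \<open>setA\<close> and the second as \<open>r + 0\<close> with 0 in
          \<open>setA\<close>.\<close>
        using Int_eq rA zero_in_setA by (auto simp: mem_setA_upto mem_setB_upto mem_translate le)
    next
      case 3
      then have "x - r \<le> r" using m by simp
      with 3 show ?thesis
        using f_second_block[OF l, of "x - r"] m
        by (auto simp: f_def thue_morse_def mem_setA_upto mem_setB_upto
            mem_translate le of_bool_def split: if_splits)
    next
      case 4
      then show ?thesis
        using CD_subset m by (auto simp: mem_setA_upto mem_setB_upto mem_translate le)
    qed
  qed
  then show ?thesis using l(2) by (intro exI[of _ l]) blast
qed

end

section \<open>The boundary cases \<open>r = 0\<close> and \<open>r = m\<close>\<close>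

lemma rep_count_1:
  assumes "0 \<in> S"
  shows "rep_count S 1 = of_bool (1 \<in> S)"
proof -
  have "{(s, s'). s \<in> S \<and> s' \<in> S \<and> s < s' \<and> s + s' = 1} = (if 1 \<in> S then {(0, 1)} else {})"
    using assms by (auto simp: add_is_1)
  then show ?thesis by (simp add: rep_count_def)
qed

lemma rep_count_top:
  assumes "S \<subseteq> {0..m}" "m \<in> S" "0 < m"
  shows "rep_count S (2 * m - 1) = of_bool (m - 1 \<in> S)"
proof -
  have pair: "s \<in> S \<and> s' \<in> S \<and> s < s' \<and> s + s' = 2 * m - 1 \<longleftrightarrow> s = m - 1 \<and> s' = m \<and> m - 1 \<in> S"
    (is "?L \<longleftrightarrow> ?R") for s s'
  proof
    assume L: ?L
    then have "s' \<le> m" using assms by auto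
    then have "s = m - 1 \<and> s' = m" using L by linarith
    then show ?R using L by blast
  next
    assume ?R
    then show ?L using assms by simp
  qed
  have eq: "{(s, s'). s \<in> S \<and> s' \<in> S \<and> s < s' \<and> s + s' = 2 * m - 1}
      = (if m - 1 \<in> S then {(m - 1, m)} else {})"
    unfolding pair by auto
  show ?thesis unfolding rep_count_def eq by simp
qed

theorem theorem7:
  fixes m r :: nat and C D :: "nat set"
  assumes "C \<union> D = {0..m}" and "C \<inter> D = {r}" and "0 \<in> C"
  shows "(\<forall>n>0. rep_count C n = rep_count D n) \<longleftrightarrow>
    (\<exists>l. C = setA_upto (2 * l) \<union> translate (2 ^ (2 * l) - 1) (setB_upto (2 * l)) \<and>
         D = setB_upto (2 * l) \<union> translate (2 ^ (2 * l) - 1) (setA_upto (2 * l)))"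
proof
  assume eq: "\<forall>n>0. rep_count C n = rep_count D n"
  have once: "x \<in> C \<longleftrightarrow> x \<notin> D" if "x \<le> m" "x \<noteq> r" for x
    using assms that by auto
  have r: "r \<in> C" "r \<in> D" "r \<le> m" using assms by auto
  consider "m = 0" | "0 < m" "r = 0" | "0 < m" "r = m" | "0 < r" "r < m"
    using r by linarith
  then show "\<exists>l. C = setA_upto (2 * l) \<union> translate (2 ^ (2 * l) - 1) (setB_upto (2 * l)) \<and>
         D = setB_upto (2 * l) \<union> translate (2 ^ (2 * l) - 1) (setA_upto (2 * l))"
  proof cases
    case 1
    then have "C = {0}" "D = {0}" using assms r by auto
    \<comment> \<open>The witness \<open>l = 0\<close> has translation by 0, with blocks {0} and the
      empty set.\<close>
    then show ?thesis
      using zero_in_setA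
      by (intro exI[of _ 0]) (auto simp: mem_setA_upto mem_setB_upto mem_translate)
  next
    case 2
    \<comment> \<open>Both sets contain 0 but only one contains 1, so the counts differ at
      1.\<close>
    then have False
      using eq[rule_format, of 1] once[of 1] r rep_count_1[of C] rep_count_1[of D] by auto
    then show ?thesis ..
  next
    case 3
    have "C \<subseteq> {0..m}" "D \<subseteq> {0..m}" using assms by auto
    moreover have "m - 1 \<in> C \<longleftrightarrow> m - 1 \<notin> D" using 3 once[of "m - 1"] by simp
    \<comment> \<open>Both sets contain \<open>m\<close> but only one contains \<open>m - 1\<close>,
      so the counts differ at \<open>2 * m - 1\<close>.\<close>
    ultimately have False
      using 3 eq[rule_format, of "2 * m - 1"] r
        rep_count_top[of C m] rep_count_top[of D m] by auto
    then show ?thesis ..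
  next
    case 4
    have "rep_count C n = rep_count D n" for n using eq by (cases n) auto
    then interpret equal_reps m r C D
      using assms 4 by unfold_locales auto
    show ?thesis by (rule characterisation)
  qed
next
  assume "\<exists>l. C = setA_upto (2 * l) \<union> translate (2 ^ (2 * l) - 1) (setB_upto (2 * l)) \<and>
         D = setB_upto (2 * l) \<union> translate (2 ^ (2 * l) - 1) (setA_upto (2 * l))"
  then show "\<forall>n>0. rep_count C n = rep_count D n"
    using rep_count_thue_morse_blocks by metis
qed

end
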